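(* Let $(J,\bullet)$ be a unital Jordan algebra over $\mathbb K$. Equip the set $J^\times$ of invertible elements with its symmetric space structure $\mu(x,y)=\sigma_x(y)=U_x(y^{-1})$. Let $a\in J^\times$ and let $\tau=\tau_{-a^{-1}}:J\to J$, $x\mapsto x-a^{-1}$, be translation by $-a^{-1}$. Then the translated symmetric space $\tau(J^\times)$ is given by $$\tau(J^\times)=\{x\in J \mid B(x,-a)\in \mathrm{GL}(J)\},$$ with product map, for all $x,y\in\tau(J^\times)$, $$\tau\bigl(\mu(\tau^{-1}(x),\tau^{-1}(y))\bigr)=2x+U_xa+B(x,-a)\,\tilde\tau_a(-y).$$
   Context: $\mathbb K$ is a commutative ring in which $2$ and $3$ are invertible. A Jordan algebra is a $\mathbb K$-module $J$ with a bilinear commutative product $\bullet$ satisfying $x\bullet(x^2\bullet y)=x^2\bullet(x\bullet y)$; here it has a unit element. $L_x y=x\bullet y$, $U_x=2L_x^2-L_{x^2}$. An element $x$ is invertible if $U_x\in\mathrm{GL}(J)$ (the group of invertible $\mathbb K$-linear endomorphisms); then $x^{-1}:=U_x^{-1}x$. $J^\times$ is the set of invertible elements. With $\mu(x,y)=U_x(y^{-1})$ it is a reflection space, i.e. the maps $\sigma_x=\mu(x,\cdot)$ satisfy $\sigma_x(x)=x$, $\sigma_x^2=\mathrm{id}$, $\sigma_x\sigma_y\sigma_x=\sigma_{\sigma_x(y)}$. The Jordan triple product of $J$ is $T(x,y,z)=2\bigl((x\bullet y)\bullet z+x\bullet(y\bullet z)-y\bullet(x\bullet z)\bigr)$, so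 that $Q(x):=\tfrac12T(x,\cdot,x)=U_x$. Write $T(x,y):=T(x,y,\cdot)$. The Bergman operator is $B(x,y)=\mathrm{id}_J-T(x,y)+Q(x)Q(y)$, and if $B(x,y)$ is invertible, the quasi-inverse is $\tilde\tau_y(x)=x^y=B(x,y)^{-1}(x-Q(x)y)$. *)

theory Defs
  imports Complex_Main
begin

locale unital_jordan_algebra = module scale
  for scale :: "'k::comm_ring_1 \<Rightarrow> 'j::ab_group_add \<Rightarrow> 'j" +
  fixes jprod :: "'j \<Rightarrow> 'j \<Rightarrow> 'j"
    and e :: 'j
  assumes jprod_add_right: "jprod x (y + z) = jprod x y + jprod x z"
    and jprod_scale_right: "jprod x (scale c y) = scale c (jprod x y)"
    and jprod_commute: "jprod x y = jprod y x"
    and jordan_identity: "jprod x (jprod (jprod x x) y) = jprod (jprod x x) (jprod x y)"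
    and unit_left: "jprod e x = x"

definition module_GL :: "('k::comm_ring_1 \<Rightarrow> 'j::ab_group_add \<Rightarrow> 'j) \<Rightarrow> ('j \<Rightarrow> 'j) set"
  where "module_GL scale = {f. module_hom scale scale f \<and> bij f}"

definition L_op :: "('j \<Rightarrow> 'j \<Rightarrow> 'j) \<Rightarrow> 'j \<Rightarrow> 'j \<Rightarrow> 'j"
  where "L_op jprod x = (\<lambda>y. jprod x y)"

definition U_op ::
  "('k::comm_ring_1 \<Rightarrow> 'j::ab_group_add \<Rightarrow> 'j) \<Rightarrow> ('j \<Rightarrow> 'j \<Rightarrow> 'j) \<Rightarrow> 'j \<Rightarrow> 'j \<Rightarrow> 'j"
  where "U_op scale jprod x =
    (\<lambda>y. scale 2 (L_op jprod x (L_op jprod x y)) - L_op jprod (jprod x x) y)"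

definition J_units ::
  "('k::comm_ring_1 \<Rightarrow> 'j::ab_group_add \<Rightarrow> 'j) \<Rightarrow> ('j \<Rightarrow> 'j \<Rightarrow> 'j) \<Rightarrow> 'j set"
  where "J_units scale jprod = {x. U_op scale jprod x \<in> module_GL scale}"

text \<open>Meaningful only for elements of \<open>J_units scale jprod\<close>.\<close>

definition J_inverse ::
  "('k::comm_ring_1 \<Rightarrow> 'j::ab_group_add \<Rightarrow> 'j) \<Rightarrow> ('j \<Rightarrow> 'j \<Rightarrow> 'j) \<Rightarrow> 'j \<Rightarrow> 'j"
  where "J_inverse scale jprod x = inv (U_op scale jprod x) x"

definition J_mu ::
  "('k::comm_ring_1 \<Rightarrow> 'j::ab_group_add \<Rightarrow> 'j) \<Rightarrow> ('j \<Rightarrow> 'j \<Rightarrow> 'j) \<Rightarrow> 'j \<Rightarrow> 'j \<Rightarrow> 'j"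
  where "J_mu scale jprod x y = U_op scale jprod x (J_inverse scale jprod y)"

definition J_triple ::
  "('k::comm_ring_1 \<Rightarrow> 'j::ab_group_add \<Rightarrow> 'j) \<Rightarrow> ('j \<Rightarrow> 'j \<Rightarrow> 'j) \<Rightarrow> 'j \<Rightarrow> 'j \<Rightarrow> 'j \<Rightarrow> 'j"
  where "J_triple scale jprod x y z =
    scale 2 (jprod (jprod x y) z + jprod x (jprod y z) - jprod y (jprod x z))"

text \<open>The scalar \<open>1/2\<close>, in a commutative ring in which \<open>2\<close> is invertible.\<close>

definition ring_half :: "'k::comm_ring_1"
  where "ring_half = (THE h. 2 * h = 1)"

definition Q_op ::
  "('k::comm_ring_1 \<Rightarrow> 'j::ab_group_add \<Rightarrow> 'j) \<Rightarrow> ('j \<Rightarrow> 'j \<Rightarrow> 'j) \<Rightarrow> 'j \<Rightarrow> 'j \<Rightarrow> 'j"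
  where "Q_op scale jprod x = (\<lambda>y. scale ring_half (J_triple scale jprod x y x))"

definition bergman ::
  "('k::comm_ring_1 \<Rightarrow> 'j::ab_group_add \<Rightarrow> 'j) \<Rightarrow> ('j \<Rightarrow> 'j \<Rightarrow> 'j) \<Rightarrow> 'j \<Rightarrow> 'j \<Rightarrow> 'j \<Rightarrow> 'j"
  where "bergman scale jprod x y =
    (\<lambda>z. z - J_triple scale jprod x y z + Q_op scale jprod x (Q_op scale jprod y z))"

text \<open>\<open>quasi_inverse scale jprod y x\<close> is $x^y$; it is meaningful only if
  \<open>bergman scale jprod x y\<close> is invertible.\<close>

definition quasi_inverse ::
  "('k::comm_ring_1 \<Rightarrow> 'j::ab_group_add \<Rightarrow> 'j) \<Rightarrow> ('j \<Rightarrow> 'j \<Rightarrow> 'j) \<Rightarrow> 'j \<Rightarrow> 'j \<Rightarrow> 'j"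
  where "quasi_inverse scale jprod y x =
    inv (bergman scale jprod x y) (x - Q_op scale jprod x y)"

lemma two_times_ring_half:
  assumes "(2::'k::comm_ring_1) dvd 1"
  shows "2 * (ring_half :: 'k) = 1"
proof -
  from assms obtain h :: 'k where h: "2 * h = 1"
    by (metis dvdE)
  have "k = h" if "2 * k = 1" for k :: 'k
  proof -
    have "k = (2 * h) * k" using h by simp
    also have "\<dots> = h * (2 * k)" by (simp only: ac_simps)
    finally show ?thesis using that by simp
  qed
  with h show ?thesis
    unfolding ring_half_def by (rule theI)
qed

lemma (in unital_jordan_algebra) Q_op_eq_U_op:
  assumes "(2::'k) dvd 1"
  shows "Q_op scale jprod x = U_op scale jprod x"
proof
  fix y
  have half: "ring_half * (2::'k) = 1"
    using two_times_ring_half[OF assms] by (simp add: mult.commute)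
  have two: "scale 2 z = z + z" for z
    using scale_left_distrib[of 1 1 z] by simp
  have "Q_op scale jprod x y =
      jprod (jprod x y) x + jprod x (jprod y x) - jprod y (jprod x x)"
    by (simp add: Q_op_def J_triple_def half)
  also have "\<dots> = U_op scale jprod x y"
    by (simp add: U_op_def L_op_def two jprod_commute[of "jprod x y" x]
        jprod_commute[of y x] jprod_commute[of y "jprod x x"])
  finally show "Q_op scale jprod x y = U_op scale jprod x y" .
qed

end

theory Submission
  imports Defs
begin

text \<open>
  Write \<open>b = a\<^sup>-\<^sup>1\<close>. Everything rests on the factorization \<open>B(x, -a) = U\<^sub>x\<^sub>+\<^sub>b U\<^sub>a\<close>.
  Expanding \<open>U\<^sub>x\<^sub>+\<^sub>b\<close>, it splits into \<open>U\<^sub>b U\<^sub>a = id\<close> and \<open>T(x, U\<^sub>a z, b) = T(x, a, z)\<close>; both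
  follow from the linearized Jordan identity once \<open>L\<^sub>a\<close> and \<open>L\<^sub>b\<close> are known to commute. The
  commutator \<open>D = [L\<^sub>a, L\<^sub>b]\<close> commutes with \<open>L\<^sub>a\<close> and satisfies \<open>U\<^sub>a D = 0\<close>, so it vanishes.
  The product formula then reduces to \<open>U\<^sub>x\<^sub>+\<^sub>b a = U\<^sub>x a + 2x + b\<close>, applied to \<open>x\<close> and to \<open>y\<close>.
\<close>

context unital_jordan_algebra
begin

section \<open>Elementary properties of the product and of \<open>U\<close>\<close>

notation jprod (infixl "\<bullet>" 70)

abbreviation U where "U \<equiv> U_op scale jprod"

lemma jprod_add_left: "(x + y) \<bullet> z = x \<bullet> z + y \<bullet> z"
  by (metis jprod_add_right jprod_commute)

lemma jprod_zero_right [simp]: "x \<bullet> 0 = 0"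
  using jprod_add_right[of x 0 0] by simp

lemma jprod_minus_right: "x \<bullet> (- y) = - (x \<bullet> y)"
  using jprod_add_right[of x y "- y"] by (simp add: eq_neg_iff_add_eq_0 add.commute)

lemma jprod_minus_left: "(- x) \<bullet> y = - (x \<bullet> y)"
  by (metis jprod_minus_right jprod_commute)

lemma jprod_diff_right: "x \<bullet> (y - z) = x \<bullet> y - x \<bullet> z"
  using jprod_add_right[of x y "- z"] by (simp add: jprod_minus_right)

lemma jprod_diff_left: "(x - y) \<bullet> z = x \<bullet> z - y \<bullet> z"
  by (metis jprod_diff_right jprod_commute)

lemmas jprod_distribs =
  jprod_add_right jprod_add_left jprod_diff_right jprod_diff_left
  jprod_minus_right jprod_minus_left

lemma unit_right [simp]: "x \<bullet> e = x"
  by (metis jprod_commute unit_left)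

lemma scale_two: "scale 2 z = z + z"
  using scale_left_distrib[of 1 1 z] by simp

lemma U_apply: "U x z = x \<bullet> (x \<bullet> z) + x \<bullet> (x \<bullet> z) - (x \<bullet> x) \<bullet> z"
  by (simp add: U_op_def L_op_def scale_two)

lemma module_hom_U: "module_hom scale scale (U x)"
  by (rule module_hom.intro[OF module_axioms module_axioms])
    (unfold_locales,
      auto simp: U_apply jprod_distribs jprod_scale_right scale_right_distrib
        scale_right_diff_distrib algebra_simps)

lemma U_add: "U x (y + z) = U x y + U x z"
  by (simp add: U_apply jprod_distribs algebra_simps)

lemma U_diff: "U x (y - z) = U x y - U x z"
  by (simp add: U_apply jprod_distribs algebra_simps)

lemma U_zero [simp]: "U x 0 = 0"
  by (simp add: U_apply)

lemma U_minus_left: "U (- x) = U x"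
  by (rule ext) (simp add: U_apply jprod_distribs)

lemma J_triple_minus_swap: "J_triple scale jprod (- x) y z = J_triple scale jprod x (- y) z"
  by (simp add: J_triple_def jprod_distribs)

text \<open>Polarization of the quadratic map \<open>x \<mapsto> U x z\<close>. The triple product
  is its polar form, which lets translations be expanded inside \<open>U\<close>.\<close>

lemma U_add_left: "U (x + y) z = U x z + J_triple scale jprod x z y + U y z"
proof -
  have "J_triple scale jprod x z y
      = (x \<bullet> (y \<bullet> z) + y \<bullet> (x \<bullet> z) - (x \<bullet> y) \<bullet> z) + (x \<bullet> (y \<bullet> z) + y \<bullet> (x \<bullet> z) - (x \<bullet> y) \<bullet> z)"
    by (simp add: J_triple_def scale_two jprod_commute algebra_simps)
  moreover have "y \<bullet> x = x \<bullet> y" by (rule jprod_commute)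
  ultimately show ?thesis
    by (simp add: U_apply jprod_distribs algebra_simps)
qed

lemma J_units_iff_bij: "x \<in> J_units scale jprod \<longleftrightarrow> bij (U x)"
  by (simp add: J_units_def module_GL_def module_hom_U)

lemma U_J_inverse:
  assumes "bij (U x)"
  shows "U x (J_inverse scale jprod x) = x"
  using assms by (simp add: J_inverse_def bij_is_surj surj_f_inv_f)

section \<open>Linearized Jordan identity\<close>

context
  assumes two_invertible: "(2::'k) dvd 1"
begin

lemma double_cancel:
  fixes x y :: 'j
  assumes "x + x = y + y"
  shows "x = y"
proof -
  have half: "ring_half * (2::'k) = 1"
    using two_times_ring_half[OF two_invertible] by (simp add: mult.commute)
  have "scale ring_half (scale 2 x) = scale ring_half (scale 2 y)"
    using assms by (simp add: scale_two)
  then show ?thesis by (simp add: half)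
qed

lemma jordan_linearized:
  "(p \<bullet> q) \<bullet> (r \<bullet> y) + (q \<bullet> r) \<bullet> (p \<bullet> y) + (r \<bullet> p) \<bullet> (q \<bullet> y)
    = r \<bullet> ((p \<bullet> q) \<bullet> y) + p \<bullet> ((q \<bullet> r) \<bullet> y) + q \<bullet> ((r \<bullet> p) \<bullet> y)"
proof -
  define F where "F x = (x \<bullet> x) \<bullet> (x \<bullet> y) - x \<bullet> ((x \<bullet> x) \<bullet> y)" for x
  have F0: "F x = 0" for x
    by (simp add: F_def jordan_identity)
  let ?A = "(p \<bullet> q) \<bullet> (r \<bullet> y) + (q \<bullet> r) \<bullet> (p \<bullet> y) + (r \<bullet> p) \<bullet> (q \<bullet> y)"
  let ?B = "r \<bullet> ((p \<bullet> q) \<bullet> y) + p \<bullet> ((q \<bullet> r) \<bullet> y) + q \<bullet> ((r \<bullet> p) \<bullet> y)"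
  have c: "q \<bullet> p = p \<bullet> q" "r \<bullet> q = q \<bullet> r" "p \<bullet> r = r \<bullet> p"
    by (rule jprod_commute)+
  \<comment> \<open>\<open>F\<close> is homogeneous of degree 3, so this alternating sum keeps only
    the part linear in each of \<open>p\<close>, \<open>q\<close>, \<open>r\<close>. Commutativity
    makes every surviving term occur twice.\<close>
  have "F (p + q + r) - F (p + q) - F (q + r) - F (p + r) + F p + F q + F r
      = (?A + ?A) - (?B + ?B)"
    by (simp add: F_def jprod_distribs c algebra_simps)
  then have "?A + ?A = ?B + ?B" by (simp add: F0)
  then show ?thesis by (rule double_cancel)
qed

text \<open>Exchanging the roles of \<open>r\<close> and \<open>y\<close> in the linearized identity
  writes multiplication by a triple product through multiplications by at most two factors. Most
  operator identities below come from choosing \<open>p\<close>, \<open>q\<close>, \<open>r\<close>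
  here.\<close>

lemma jprod_assoc_expand:
  "((p \<bullet> q) \<bullet> r) \<bullet> y = (p \<bullet> q) \<bullet> (r \<bullet> y) + (q \<bullet> r) \<bullet> (p \<bullet> y) + (p \<bullet> r) \<bullet> (q \<bullet> y)
    - p \<bullet> (r \<bullet> (q \<bullet> y)) - q \<bullet> (r \<bullet> (p \<bullet> y))"
  using jordan_linearized[of p q y r] by (simp add: jprod_commute algebra_simps)

section \<open>Multiplication operators of an element and its inverse\<close>

lemma sq_commutes_with_inverse:
  assumes "a \<bullet> b = e"
  shows "(a \<bullet> a) \<bullet> (b \<bullet> z) = b \<bullet> ((a \<bullet> a) \<bullet> z)"
proof -
  have "b \<bullet> a = e" using assms by (simp add: jprod_commute)
  then show ?thesis
    using jordan_linearized[of a a b z] assms by (simp add: unit_left algebra_simps)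
qed

lemma commute_with_inverse:
  assumes ab: "a \<bullet> b = e" and aab: "(a \<bullet> a) \<bullet> b = a" and inj: "inj (U a)"
  shows "a \<bullet> (b \<bullet> z) = b \<bullet> (a \<bullet> z)"
proof -
  have ba: "b \<bullet> a = e" using ab by (simp add: jprod_commute)
  note sq_a = jordan_identity[of a]
  note sq_b = sq_commutes_with_inverse[OF ab]
  \<comment> \<open>Two expansions of multiplication by \<open>a\<close>: \<open>eq1\<close> reads
    \<open>a\<close> as \<open>(a \<bullet> a) \<bullet> b\<close>, \<open>eq2\<close> as
    \<open>(a \<bullet> b) \<bullet> a\<close>. Comparing them shows that \<open>D\<close> commutes
    with multiplication by \<open>a\<close>.\<close>
  have eq1: "a \<bullet> (b \<bullet> (a \<bullet> w)) + a \<bullet> (b \<bullet> (a \<bullet> w)) = a \<bullet> w + (a \<bullet> a) \<bullet> (b \<bullet> w)" for w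
    using jprod_assoc_expand[of a a b w] by (simp add: ab ba aab unit_left algebra_simps)
  have eq2: "a \<bullet> (a \<bullet> (b \<bullet> w)) + b \<bullet> (a \<bullet> (a \<bullet> w)) = a \<bullet> w + (a \<bullet> a) \<bullet> (b \<bullet> w)" for w
    using jprod_assoc_expand[of a b a w] by (simp add: ab ba aab unit_left algebra_simps)
  define D where "D w = a \<bullet> (b \<bullet> w) - b \<bullet> (a \<bullet> w)" for w
  have aD: "a \<bullet> D w = D (a \<bullet> w)" for w
    using eq1[of w] eq2[of w] by (simp add: D_def jprod_distribs algebra_simps)
  \<comment> \<open>As \<open>D (a \<bullet> z) = a \<bullet> D z\<close>, this equation says
    exactly that \<open>U a (D z) = 0\<close>.\<close>
  have "a \<bullet> (D (a \<bullet> z)) + a \<bullet> (D (a \<bullet> z)) = (a \<bullet> a) \<bullet> D z"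
  proof -
    have "a \<bullet> (D (a \<bullet> z)) + a \<bullet> (D (a \<bullet> z))
        = a \<bullet> (a \<bullet> (b \<bullet> (a \<bullet> z)) + a \<bullet> (b \<bullet> (a \<bullet> z)))
          - (a \<bullet> (b \<bullet> (a \<bullet> (a \<bullet> z))) + a \<bullet> (b \<bullet> (a \<bullet> (a \<bullet> z))))"
      by (simp add: D_def jprod_distribs algebra_simps)
    also have "\<dots> = (a \<bullet> a) \<bullet> D z"
      by (simp only: eq1) (simp add: D_def jprod_distribs sq_a)
    finally show ?thesis .
  qed
  then have "U a (D z) = U a 0"
    by (simp add: U_apply aD)
  then have "D z = 0" by (rule injD[OF inj])
  then show ?thesis by (simp add: D_def)
qed

text \<open>Supplies the terms that arise when \<open>U (x + b)\<close> is expanded at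
  \<open>a\<close> and at \<open>U a z\<close>. With commutation available, they follow from
  suitable instances of \<open>jprod_assoc_expand\<close>.\<close>

lemma U_inverse_pair:
  assumes ab: "a \<bullet> b = e" and aab: "(a \<bullet> a) \<bullet> b = a"
    and comm: "\<And>z. a \<bullet> (b \<bullet> z) = b \<bullet> (a \<bullet> z)"
  shows "U a (b \<bullet> z) = a \<bullet> z"
    and "U b a = b"
    and "U a (U b z) = z"
    and "J_triple scale jprod x a b = x + x"
    and "J_triple scale jprod x (U a z) b = J_triple scale jprod x a z"
proof -
  have ba: "b \<bullet> a = e" using ab by (simp add: jprod_commute)
  note sq_b = sq_commutes_with_inverse[OF ab]
  note sqb_a = sq_commutes_with_inverse[OF ba]
  show Ub: "U a (b \<bullet> z) = a \<bullet> z" for z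
    using jprod_assoc_expand[of a a b z]
    by (simp add: U_apply ab ba aab unit_left comm algebra_simps)
  have bba: "(b \<bullet> b) \<bullet> a = b"
    using comm[of b] by (simp add: ab jprod_commute)
  then show "U b a = b"
    by (simp add: U_apply ba)
  have sqsq: "(a \<bullet> a) \<bullet> (b \<bullet> b) = e"
    using sq_b[of b] by (simp add: aab ba)
  have abb: "a \<bullet> (b \<bullet> b) = b" using bba by (simp add: jprod_commute)
  \<comment> \<open>The choice \<open>r = b \<bullet> b\<close> works because
    \<open>(a \<bullet> a) \<bullet> (b \<bullet> b) = e\<close> and
    \<open>a \<bullet> (b \<bullet> b) = b\<close> collapse the products in the expansion.\<close>
  have W: "U a ((b \<bullet> b) \<bullet> w) = a \<bullet> (b \<bullet> w) + a \<bullet> (b \<bullet> w) - w" for w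
    using jprod_assoc_expand[of a a "b \<bullet> b" w]
    by (simp add: U_apply sqsq abb bba ab unit_left comm sqb_a algebra_simps)
  show UU: "U a (U b w) = w" for w
  proof -
    have "U a (U b w) = U a (b \<bullet> (b \<bullet> w)) + U a (b \<bullet> (b \<bullet> w)) - U a ((b \<bullet> b) \<bullet> w)"
      by (simp add: U_apply[of b] U_add U_diff)
    then show ?thesis by (simp add: Ub W)
  qed
  show "J_triple scale jprod x a b = x + x"
  proof -
    have "(x \<bullet> a) \<bullet> b + x \<bullet> (a \<bullet> b) - a \<bullet> (x \<bullet> b) = x"
      using comm[of x] by (simp add: ab jprod_commute[of x a] jprod_commute[of x b]
          jprod_commute[of "a \<bullet> x" b])
    then show ?thesis by (simp add: J_triple_def scale_two)
  qed
  \<comment> \<open>Up to the factor 2, \<open>T(x, a, w)\<close> is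
    \<open>M w + x \<bullet> (a \<bullet> w)\<close> and \<open>T(x, w, b)\<close> is
    \<open>N w + x \<bullet> (b \<bullet> w)\<close>. The last claim thus reduces to
    \<open>N (U a z) = M z\<close> and \<open>b \<bullet> U a z = a \<bullet> z\<close>.\<close>
  define M where "M w = (a \<bullet> x) \<bullet> w - a \<bullet> (x \<bullet> w)" for w
  define N where "N w = b \<bullet> (x \<bullet> w) - (b \<bullet> x) \<bullet> w" for w
  have MN: "M (b \<bullet> w) = N (a \<bullet> w)" for w
    using jprod_assoc_expand[of a b x w]
    by (simp add: M_def N_def ab unit_left algebra_simps)
  have sq1: "((a \<bullet> a) \<bullet> x) \<bullet> w - (a \<bullet> a) \<bullet> (x \<bullet> w) = M (a \<bullet> w) + M (a \<bullet> w)" for w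
    using jprod_assoc_expand[of a a x w] by (simp add: M_def algebra_simps)
  have sq2: "M w = (((a \<bullet> a) \<bullet> x) \<bullet> (b \<bullet> w) - (a \<bullet> a) \<bullet> (x \<bullet> (b \<bullet> w))) - N ((a \<bullet> a) \<bullet> w)" for w
    using jprod_assoc_expand[of "a \<bullet> a" b x w] by (simp add: M_def N_def aab algebra_simps)
  have "N (U a z) = N (a \<bullet> (a \<bullet> z)) + N (a \<bullet> (a \<bullet> z)) - N ((a \<bullet> a) \<bullet> z)"
    by (simp add: N_def U_apply jprod_distribs algebra_simps)
  \<comment> \<open>By \<open>sq2\<close> and \<open>sq1\<close>, \<open>M z\<close> is twice
    \<open>M (a \<bullet> (b \<bullet> z))\<close> minus
    \<open>N ((a \<bullet> a) \<bullet> z)\<close>. Commutation and \<open>MN\<close> turn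
    \<open>M (a \<bullet> (b \<bullet> z))\<close> into
    \<open>N (a \<bullet> (a \<bullet> z))\<close>.\<close>
  also have "\<dots> = M z"
    using sq2[of z] sq1[of "b \<bullet> z"] by (simp add: MN[symmetric] comm)
  finally have NU: "N (U a z) = M z" .
  have bU: "b \<bullet> U a z = a \<bullet> z"
    using Ub[of z] by (simp add: U_apply jprod_distribs comm sq_b)
  have "(x \<bullet> U a z) \<bullet> b + x \<bullet> (U a z \<bullet> b) - U a z \<bullet> (x \<bullet> b) = N (U a z) + x \<bullet> (b \<bullet> U a z)"
    by (simp add: N_def jprod_commute algebra_simps)
  also have "\<dots> = (x \<bullet> a) \<bullet> z + x \<bullet> (a \<bullet> z) - a \<bullet> (x \<bullet> z)"
    by (simp add: NU bU M_def jprod_commute[of x a])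
  finally show "J_triple scale jprod x (U a z) b = J_triple scale jprod x a z"
    by (simp add: J_triple_def)
qed

text \<open>Links the operator \<open>B(-y, a)\<close> that defines the quasi-inverse of
  \<open>-y\<close> to \<open>B(y, -a)\<close>, the form that is factorized below.\<close>

lemma bergman_minus: "bergman scale jprod (- x) y = bergman scale jprod x (- y)"
  by (rule ext)
    (simp add: bergman_def Q_op_eq_U_op[OF two_invertible] U_minus_left J_triple_minus_swap)

section \<open>Bergman operator and translated product\<close>

context
  fixes a b
  assumes bij_a: "bij (U a)"
    and b_def: "b = J_inverse scale jprod a"
begin

lemma unit_inverse: "a \<bullet> b = e" "(a \<bullet> a) \<bullet> b = a" "a \<bullet> (b \<bullet> z) = b \<bullet> (a \<bullet> z)"
proof -
  have inj: "inj (U a)" using bij_a by (rule bij_is_inj)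
  have Uab: "U a b = a" by (simp add: b_def U_J_inverse[OF bij_a])
  \<comment> \<open>The Jordan identity makes \<open>U a\<close> commute with multiplication by
    \<open>a\<close>. Since \<open>U a e = a \<bullet> a\<close>, injectivity of \<open>U a\<close>
    then yields \<open>a \<bullet> b = e\<close>.\<close>
  have "U a (a \<bullet> b) = a \<bullet> U a b"
    by (simp add: U_apply jprod_distribs jordan_identity)
  also have "\<dots> = U a e" by (simp only: Uab) (simp add: U_apply)
  finally show ab: "a \<bullet> b = e" by (rule injD[OF inj])
  show aab: "(a \<bullet> a) \<bullet> b = a"
    using Uab by (simp add: U_apply ab algebra_simps)
  show "a \<bullet> (b \<bullet> z) = b \<bullet> (a \<bullet> z)"
    by (rule commute_with_inverse[OF ab aab inj])
qed

lemmas unit_pair = U_inverse_pair[OF unit_inverse]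

lemma U_inverse_left: "U b (U a z) = z"
  by (rule injD[OF bij_is_inj[OF bij_a]]) (simp add: unit_pair)

lemma bergman_factorization: "bergman scale jprod x (- a) = U (x + b) \<circ> U a"
proof
  fix z
  have "J_triple scale jprod x (- a) z = - J_triple scale jprod x a z"
    by (simp add: J_triple_def jprod_distribs scale_two)
  then show "bergman scale jprod x (- a) z = (U (x + b) \<circ> U a) z"
    by (simp add: bergman_def Q_op_eq_U_op[OF two_invertible] U_minus_left U_add_left
        unit_pair U_inverse_left)
qed

lemma bergman_GL_iff: "bergman scale jprod x (- a) \<in> module_GL scale \<longleftrightarrow> bij (U (x + b))"
proof -
  have "module_hom scale scale (U (x + b) \<circ> U a)"
    by (rule module_hom_compose[OF module_hom_U module_hom_U])
  moreover have "bij (U (x + b) \<circ> U a) \<longleftrightarrow> bij (U (x + b))"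
    using bij_a by (metis bij_comp bij_betw_comp_iff)
  ultimately show ?thesis
    by (simp add: module_GL_def bergman_factorization)
qed

lemma U_translate: "U (x + b) a = U x a + (x + x) + b"
  by (simp add: U_add_left unit_pair)

text \<open>With \<open>c\<close> the inverse of \<open>y + b\<close>, the factorization sends
  \<open>U b c - b\<close> to \<open>U (y + b) c - U (y + b) a\<close>, that is, to
  \<open>- y - U y a\<close>. Injectivity of the Bergman operator identifies the preimage.\<close>

lemma quasi_inverse_eq:
  assumes "bij (U (y + b))"
  shows "quasi_inverse scale jprod a (- y) = U b (J_inverse scale jprod (y + b)) - b"
proof -
  let ?B = "bergman scale jprod (- y) a"
  have B: "?B = U (y + b) \<circ> U a"
    by (simp add: bergman_minus bergman_factorization)
  then have "inj ?B"
    using bij_comp[OF bij_a assms] by (simp add: bij_is_inj)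
  moreover have "?B (U b (J_inverse scale jprod (y + b)) - b) = - y - Q_op scale jprod (- y) a"
  proof -
    have "U a b = a" by (simp add: b_def U_J_inverse[OF bij_a])
    then show ?thesis
      by (simp add: B U_diff unit_pair U_J_inverse[OF assms] U_translate
          Q_op_eq_U_op[OF two_invertible] U_minus_left)
  qed
  ultimately show ?thesis
    unfolding quasi_inverse_def by (metis inv_f_f)
qed

text \<open>With \<open>c\<close> the inverse of \<open>y + b\<close>, the Bergman term equals
  \<open>U (x + b) c - U (x + b) a\<close>. Adding \<open>2x + U x a\<close> cancels all of
  \<open>U (x + b) a\<close> except \<open>b\<close>, which is the translation back.\<close>

lemma translated_mu:
  assumes "bij (U (y + b))"
  shows "J_mu scale jprod (x + b) (y + b) - b
    = scale 2 x + U x a + bergman scale jprod x (- a) (quasi_inverse scale jprod a (- y))"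
proof -
  have "U a b = a" by (simp add: b_def U_J_inverse[OF bij_a])
  then show ?thesis
    by (simp add: J_mu_def quasi_inverse_eq[OF assms] bergman_factorization U_diff unit_pair
        U_translate scale_two)
qed

end

end

end

theorem proposition2p2:
  fixes scale :: "'k::comm_ring_1 \<Rightarrow> 'j::ab_group_add \<Rightarrow> 'j"
    and jprod :: "'j \<Rightarrow> 'j \<Rightarrow> 'j"
    and e a :: 'j
    and \<tau> :: "'j \<Rightarrow> 'j"
  assumes two_invertible: "(2::'k) dvd 1"
    and three_invertible: "(3::'k) dvd 1"
    and jordan: "unital_jordan_algebra scale jprod e"
    and a_unit: "a \<in> J_units scale jprod"
    and tau: "\<tau> = (\<lambda>x. x - J_inverse scale jprod a)"
  shows "\<tau> ` J_units scale jprod = {x. bergman scale jprod x (- a) \<in> module_GL scale}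
    \<and> (\<forall>x \<in> \<tau> ` J_units scale jprod. \<forall>y \<in> \<tau> ` J_units scale jprod.
          bergman scale jprod (- y) a \<in> module_GL scale
        \<and> \<tau> (J_mu scale jprod (inv \<tau> x) (inv \<tau> y))
            = scale 2 x + U_op scale jprod x a
              + bergman scale jprod x (- a) (quasi_inverse scale jprod a (- y)))"
proof -
  interpret unital_jordan_algebra scale jprod e by (rule jordan)
  define b where "b = J_inverse scale jprod a"
  have bij_a: "bij (U_op scale jprod a)"
    using a_unit by (simp add: J_units_iff_bij)
  note facts = two_invertible bij_a b_def
  have tau_b: "\<tau> = (\<lambda>x. x - b)" by (simp add: tau b_def)
  have inv_tau: "inv \<tau> x = x + b" for x
    by (rule inv_f_eq) (auto simp: tau_b inj_def)
  have image: "x \<in> \<tau> ` J_units scale jprod \<longleftrightarrow> bij (U_op scale jprod (x + b))" for x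
  proof -
    have "x \<in> \<tau> ` J_units scale jprod \<longleftrightarrow> x + b \<in> J_units scale jprod"
      by (force simp: tau_b image_iff)
    then show ?thesis by (simp add: J_units_iff_bij)
  qed
  show ?thesis
  proof (intro conjI ballI)
    show "\<tau> ` J_units scale jprod = {x. bergman scale jprod x (- a) \<in> module_GL scale}"
      using image bergman_GL_iff[OF facts] by auto
  next
    fix x y
    assume "y \<in> \<tau> ` J_units scale jprod"
    then have y: "bij (U_op scale jprod (y + b))" by (simp add: image)
    \<comment> \<open>This guarantees that the quasi-inverse of \<open>-y\<close> is a genuine one
      and not an arbitrary value of \<open>inv\<close>.\<close>
    then show "bergman scale jprod (- y) a \<in> module_GL scale"
      by (simp add: bergman_minus[OF two_invertible] bergman_GL_iff[OF facts])
    show "\<tau> (J_mu scale jprod (inv \<tau> x) (inv \<tau> y))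
        = scale 2 x + U_op scale jprod x a
          + bergman scale jprod x (- a) (quasi_inverse scale jprod a (- y))"
      unfolding inv_tau using translated_mu[OF facts y, of x] by (simp add: tau_b)
  qed
qed

end
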